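(* Let $n\ge 2$, $\alpha>0$, and let $\mathbf{c}=(c_1,\dots,c_n)\in\mathbb{R}^n_+$ be a nonnegative vector with $c_1=0$ such that the fractional Hadamard power $P^{\circ\alpha}$ of the generalized Pascal matrix $P$ with generating vector $\mathbf{c}$ is positive definite. Then for every $m\ge 2$, if $\mathcal{A}$ is the $m$th order $n$-dimensional generalized Pascal tensor with generating vector $\mathbf{c}$, the tensor $\mathcal{A}^{\circ\alpha}$ is strongly completely positive, and if $m$ is even then $\mathcal{A}^{\circ\alpha}$ is positive definite.
   Context: For a nonnegative $\mathbf{c}\in\mathbb{R}^n$ and $m\ge 2$, the $m$th order $n$-dimensional generalized Pascal tensor with generating vector $\mathbf{c}$ is $\mathcal{A}=(a_{i_1\dots i_m})$ with $a_{i_1\dots i_m}=\frac{\Gamma(c_{i_1}+\dots+c_{i_m}+1)}{\Gamma(c_{i_1}+1)\cdots\Gamma(c_{i_m}+1)}$; for $m=2$ it is the generalized Pascal matrix. For a nonnegative tensor $\mathcal{A}=(a_{i_1\dots i_m})$ and $\alpha>0$, its fractional Hadamard power is $\mathcal{A}^{\circ\alpha}=(a_{i_1\dots i_m}^{\alpha})$. A symmetric tensor of order $m$, dimension $n$ is strongly completely positive if it equals $\sum_{k=1}^r(\mathbf{u}^{(k)})^m$ for nonnegative vectors $\mathbf{u}^{(k)}\in\mathbb{R}^n$ spanning $\mathbb{R}^n$, where $\mathbf{u}^m$ has entries $u_{i_1}\cdots u_{i_m}$. For even $m$, a symmetric tensor $(b_{i_1\dots i_m})$ is positive definite if $\sum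 b_{i_1\dots i_m}x_{i_1}\cdots x_{i_m}>0$ for all nonzero $\mathbf{x}\in\mathbb{R}^n$. *)

theory Defs
  imports "HOL-Analysis.Analysis"
begin

text \<open>Vectors in R^n are functions nat => real, only the coordinates 0..n-1 matter
  (0-based: the paper's c_1 is c 0).  An m-th order n-dimensional tensor is a function
  on index lists; only lists of length m with entries < n matter.\<close>

definition tindices :: "nat \<Rightarrow> nat \<Rightarrow> nat list set" where
  "tindices n m = {is. length is = m \<and> set is \<subseteq> {..<n}}"

definition pascal_tensor :: "(nat \<Rightarrow> real) \<Rightarrow> nat list \<Rightarrow> real" where
  "pascal_tensor c is =
     Gamma (sum_list (map c is) + 1) / prod_list (map (\<lambda>i. Gamma (c i + 1)) is)"

definition pascal_matrix :: "(nat \<Rightarrow> real) \<Rightarrow> nat \<Rightarrow> nat \<Rightarrow> real" where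
  "pascal_matrix c i j = Gamma (c i + c j + 1) / (Gamma (c i + 1) * Gamma (c j + 1))"

text \<open>Fractional Hadamard powers (entrywise, entries are nonnegative).\<close>
definition hadamard_powr_tensor :: "(nat list \<Rightarrow> real) \<Rightarrow> real \<Rightarrow> nat list \<Rightarrow> real" where
  "hadamard_powr_tensor A \<alpha> is = A is powr \<alpha>"

definition hadamard_powr_matrix :: "(nat \<Rightarrow> nat \<Rightarrow> real) \<Rightarrow> real \<Rightarrow> nat \<Rightarrow> nat \<Rightarrow> real" where
  "hadamard_powr_matrix P \<alpha> i j = P i j powr \<alpha>"

definition matrix_pos_def :: "nat \<Rightarrow> (nat \<Rightarrow> nat \<Rightarrow> real) \<Rightarrow> bool" where
  "matrix_pos_def n P \<longleftrightarrow>
     (\<forall>x::nat \<Rightarrow> real. (\<exists>i<n. x i \<noteq> 0) \<longrightarrow>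
        (\<Sum>i<n. \<Sum>j<n. P i j * x i * x j) > 0)"

definition tensor_pos_def :: "nat \<Rightarrow> nat \<Rightarrow> (nat list \<Rightarrow> real) \<Rightarrow> bool" where
  "tensor_pos_def n m A \<longleftrightarrow>
     (\<forall>x::nat \<Rightarrow> real. (\<exists>i<n. x i \<noteq> 0) \<longrightarrow>
        (\<Sum>is\<in>tindices n m. A is * prod_list (map x is)) > 0)"

definition tpow :: "(nat \<Rightarrow> real) \<Rightarrow> nat list \<Rightarrow> real" where
  "tpow u is = prod_list (map u is)"

definition strongly_completely_positive :: "nat \<Rightarrow> nat \<Rightarrow> (nat list \<Rightarrow> real) \<Rightarrow> bool" where
  "strongly_completely_positive n m A \<longleftrightarrow>
     (\<exists>(r::nat) (u::nat \<Rightarrow> nat \<Rightarrow> real).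
        (\<forall>k<r. \<forall>i<n. u k i \<ge> 0) \<and>
        (\<forall>x::nat \<Rightarrow> real. \<exists>a::nat \<Rightarrow> real. \<forall>i<n. x i = (\<Sum>k<r. a k * u k i)) \<and>
        (\<forall>is\<in>tindices n m. A is = (\<Sum>k<r. tpow (u k) is)))"

end

theory Submission
  imports Defs
begin

text \<open>Up to a rank-one Hadamard factor the entries are \<open>\<Gamma>(s + 1)\<^sup>\<alpha>\<close> with
  \<open>s = c\<^sub>i\<^sub>1 + \<dots> + c\<^sub>i\<^sub>m\<close>.  By Euler's product this is a limit of products of rank-one tensors
  and factors \<open>(s + d) powr - \<alpha>\<close> with \<open>d > 0\<close>; each factor is the limit for \<open>h \<rightarrow> 0\<close> of
  \<open>h powr \<alpha> * (1 - exp (- h * (s + d))) powr - \<alpha>\<close>, whose binomial expansion has nonnegative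
  coefficients and rank-one terms.  Completely positive tensors are closed under Hadamard products
  and (by Caratheodory's theorem and compactness) under limits, so the tensor is completely positive
  for every \<open>c \<ge> 0\<close>.  As \<open>c\<^sub>1 = 0\<close>, fixing all but two of its indices to be 1 yields the
  Pascal matrix, whose definiteness forces the vectors of any decomposition to span and gives
  the definiteness of the tensor.\<close>

section \<open>Homogeneous linear systems\<close>

text \<open>Gaussian elimination by induction on the equations: an unknown \<open>k0\<close> with
  nonzero coefficient in equation \<open>e\<close> is solved for and substituted into the rest,
  which removes one equation and one unknown.\<close>

lemma homogeneous_system_nontrivial_solution:
  fixes M :: "'k \<Rightarrow> 'e \<Rightarrow> real"
  assumes "finite E" "finite K" "card E < card K"
  shows "\<exists>l. (\<exists>k\<in>K. l k \<noteq> 0) \<and> (\<forall>e\<in>E. (\<Sum>k\<in>K. l k * M k e) = 0)"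
  using assms
proof (induction E arbitrary: K M rule: finite_induct)
  case empty
  then obtain k where "k \<in> K" by fastforce
  then show ?case by (intro exI[of _ "\<lambda>_. 1"]) auto
next
  case (insert e E)
  show ?case
  proof (cases "\<forall>k\<in>K. M k e = 0")
    case True
    have "card E < card K" using insert by simp
    from insert.IH[OF insert.prems(1) this, of M] show ?thesis using True by auto
  next
    case False
    then obtain k0 where k0: "k0 \<in> K" "M k0 e \<noteq> 0" by auto
    define K' where "K' = K - {k0}"
    define M' where "M' = (\<lambda>k e'. M k e' - M k e / M k0 e * M k0 e')"
    have "finite K'" "card E < card K'" using insert k0 by (auto simp: K'_def)
    from insert.IH[OF this, of M'] obtain l
      where l: "\<exists>k\<in>K'. l k \<noteq> 0" "\<And>e'. e' \<in> E \<Longrightarrow> (\<Sum>k\<in>K'. l k * M' k e') = 0"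
      by auto
    \<comment> \<open>The value at \<open>k0\<close> is the one forced by equation \<open>e\<close>.
      Substituting it turns the coefficients \<open>M\<close> of the other unknowns into
      \<open>M'\<close>.\<close>
    define l' where "l' = l(k0 := - (\<Sum>k\<in>K'. l k * M k e / M k0 e))"
    have eq: "(\<Sum>k\<in>K. l' k * M k e') = (\<Sum>k\<in>K'. l k * M' k e')" for e'
    proof -
      have "(\<Sum>k\<in>K. l' k * M k e') = l' k0 * M k0 e' + (\<Sum>k\<in>K'. l' k * M k e')"
        unfolding K'_def using k0 insert.prems by (simp add: sum.remove)
      also have "(\<Sum>k\<in>K'. l' k * M k e') = (\<Sum>k\<in>K'. l k * M k e')"
        by (intro sum.cong) (auto simp: l'_def K'_def)
      also have "l' k0 * M k0 e' = - (\<Sum>k\<in>K'. l k * (M k e / M k0 e * M k0 e'))"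
        by (simp add: l'_def sum_distrib_right mult.assoc)
      finally show ?thesis
        by (simp add: M'_def right_diff_distrib sum_subtractf)
    qed
    have "M' k e = 0" for k using k0 by (simp add: M'_def)
    moreover have "\<exists>k\<in>K. l' k \<noteq> 0" using l(1) by (auto simp: l'_def K'_def)
    ultimately show ?thesis using l(2) by (intro exI[of _ l']) (auto simp: eq)
  qed
qed

text \<open>The \<open>n\<close> columns of \<open>Q\<close> and the vector \<open>x\<close> are
  \<open>n + 1\<close> vectors with \<open>n\<close> coordinates, hence dependent. The coefficient
  of \<open>x\<close> in a relation is nonzero, since a relation among the columns alone would make
  the quadratic form vanish at a nonzero vector.\<close>

lemma matrix_pos_def_solvable:
  assumes "matrix_pos_def n Q"
  shows "\<exists>y. \<forall>i<n. x i = (\<Sum>j<n. Q i j * y j)"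
proof -
  \<comment> \<open>Unknowns below \<open>n\<close> weight the columns of \<open>Q\<close>; unknown
    \<open>n\<close> weights \<open>x\<close>.\<close>
  define M where "M = (\<lambda>k i. if k < n then Q i k else x i)"
  have "\<exists>l. (\<exists>k\<in>{..n}. l k \<noteq> 0) \<and> (\<forall>i\<in>{..<n}. (\<Sum>k\<in>{..n}. l k * M k i) = 0)"
    by (rule homogeneous_system_nontrivial_solution) auto
  then obtain l where l: "\<exists>k\<in>{..n}. l k \<noteq> 0"
    and "\<forall>i\<in>{..<n}. (\<Sum>k\<in>{..n}. l k * M k i) = 0" by blast
  then have eq: "(\<Sum>k<n. Q i k * l k) + l n * x i = 0" if "i < n" for i
    using that by (simp add: M_def mult.commute lessThan_Suc_atMost[symmetric])
  have "l n \<noteq> 0"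
  proof
    assume "l n = 0"
    then have "\<exists>i<n. l i \<noteq> 0" using l by (metis atMost_iff nat_less_le)
    then have "(\<Sum>i<n. \<Sum>j<n. Q i j * l i * l j) > 0"
      using assms by (auto simp: matrix_pos_def_def)
    also have "(\<Sum>i<n. \<Sum>j<n. Q i j * l i * l j) = (\<Sum>i<n. l i * (\<Sum>j<n. Q i j * l j))"
      by (simp add: sum_distrib_left mult_ac)
    also have "\<dots> = 0" using eq \<open>l n = 0\<close> by simp
    finally show False by simp
  qed
  have "x i = (\<Sum>j<n. Q i j * (- l j / l n))" if "i < n" for i
  proof -
    have "(\<Sum>j<n. Q i j * (- l j / l n)) = - (\<Sum>j<n. Q i j * l j) / l n"
      by (simp add: sum_divide_distrib sum_negf)
    also have "\<dots> = x i"
      using eq[OF that] \<open>l n \<noteq> 0\<close> by (simp add: add_eq_0_iff2)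
    finally show ?thesis ..
  qed
  then show ?thesis by (intro exI[of _ "\<lambda>j. - l j / l n"]) blast
qed

section \<open>Completely positive tensors\<close>

lemma tindices_0 [simp]: "tindices n 0 = {[]}"
  by (auto simp: tindices_def)

lemma tindices_Suc: "tindices n (Suc m) = (\<lambda>(i, is). i # is) ` ({..<n} \<times> tindices n m)"
  by (force simp: tindices_def length_Suc_conv image_iff)

lemma finite_tindices [simp]: "finite (tindices n m)"
  by (induction m) (auto simp: tindices_Suc)

lemma replicate_in_tindices: "i < n \<Longrightarrow> replicate m i \<in> tindices n m"
  by (auto simp: tindices_def)

text \<open>Expanding the power one factor at a time produces one term per index list. Thus the form
  of a sum of rank-one tensors is a sum of \<open>m\<close>-th powers of linear forms, nonnegative
  for even \<open>m\<close>.\<close>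

lemma sum_tpow_mult:
  "(\<Sum>is\<in>tindices n m. tpow u is * prod_list (map x is)) = (\<Sum>i<n. u i * x i) ^ m"
proof (induction m)
  case (Suc m)
  have "(\<Sum>is\<in>tindices n (Suc m). tpow u is * prod_list (map x is))
     = (\<Sum>(i, is)\<in>{..<n} \<times> tindices n m. (u i * x i) * (tpow u is * prod_list (map x is)))"
    unfolding tindices_Suc
    by (subst sum.reindex) (auto simp: inj_on_def tpow_def mult_ac intro!: sum.cong)
  also have "\<dots> = (\<Sum>i<n. u i * x i) * (\<Sum>is\<in>tindices n m. tpow u is * prod_list (map x is))"
    by (simp add: sum_product sum.cartesian_product)
  finally show ?case using Suc by simp
qed (simp add: tpow_def)

lemma tpow_mult: "tpow (\<lambda>i. u i * v i) is = tpow u is * tpow v is"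
  by (induction "is") (auto simp: tpow_def)

lemma tpow_const: "tpow (\<lambda>_. d) is = d ^ length is"
  by (induction "is") (auto simp: tpow_def)

lemma tpow_exp: "tpow (\<lambda>i. exp (b * c i)) is = exp (b * sum_list (map c is))"
  by (induction "is") (auto simp: tpow_def exp_add distrib_left)

section \<open>Decompositions with a prescribed number of terms\<close>

text \<open>The number of terms is a parameter because the limit argument needs a uniform one. Zero
  vectors are allowed, so \<open>r\<close> is an upper bound for the least number of terms.\<close>

definition cp_rank :: "nat \<Rightarrow> nat \<Rightarrow> nat \<Rightarrow> (nat list \<Rightarrow> real) \<Rightarrow> bool" where
  "cp_rank n m r T \<longleftrightarrow> (\<exists>u. (\<forall>k<r. \<forall>i<n. u k i \<ge> 0) \<and>
     (\<forall>is\<in>tindices n m. T is = (\<Sum>k<r. tpow (u k) is)))"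

text \<open>\<open>tpow\<close> is homogeneous of degree \<open>m\<close>, so a weight
  \<open>a k\<close> is absorbed by scaling the vector with \<open>root m (a k)\<close>.\<close>

lemma cp_rank_weighted:
  assumes "finite K" "card K = r" "m > 0"
    and a: "\<And>k. k \<in> K \<Longrightarrow> a k \<ge> 0"
    and u: "\<And>k i. k \<in> K \<Longrightarrow> i < n \<Longrightarrow> u k i \<ge> 0"
    and T: "\<And>is. is \<in> tindices n m \<Longrightarrow> T is = (\<Sum>k\<in>K. a k * tpow (u k) is)"
  shows "cp_rank n m r T"
proof -
  obtain h where h: "bij_betw h {..<r} K"
    using ex_bij_betw_nat_finite[OF assms(1)] assms(2) by (auto simp: atLeast0LessThan)
  define v where "v = (\<lambda>k i. root m (a (h k)) * u (h k) i)"
  have hK: "h k \<in> K" if "k < r" for k using h that by (auto simp: bij_betw_def)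
  have "T is = (\<Sum>k<r. tpow (v k) is)" if "is": "is \<in> tindices n m" for "is"
  proof -
    have "tpow (v k) is = a (h k) * tpow (u (h k)) is" if "k < r" for k
      unfolding v_def tpow_mult tpow_const using a[OF hK[OF that]] \<open>m > 0\<close> "is"
      by (simp add: tindices_def)
    then have "(\<Sum>k<r. tpow (v k) is) = (\<Sum>k<r. a (h k) * tpow (u (h k)) is)" by simp
    also have "\<dots> = (\<Sum>k\<in>K. a k * tpow (u k) is)"
      by (rule sum.reindex_bij_betw[OF h])
    finally show ?thesis using T[OF "is"] by simp
  qed
  moreover have "v k i \<ge> 0" if "k < r" "i < n" for k i
    using a u hK that \<open>m > 0\<close> by (simp add: v_def)
  ultimately show ?thesis unfolding cp_rank_def by blast
qed

lemma cp_rank_mono: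
  assumes "cp_rank n m r T" "r \<le> r'" "m > 0"
  shows "cp_rank n m r' T"
proof -
  obtain u :: "nat \<Rightarrow> nat \<Rightarrow> real" where u: "\<forall>k<r. \<forall>i<n. u k i \<ge> 0"
    and T: "\<forall>is\<in>tindices n m. T is = (\<Sum>k<r. tpow (u k) is)"
    using assms unfolding cp_rank_def by blast
  have "(\<Sum>k<r'. (if k < r then 1 else 0) * tpow (\<lambda>i. if k < r then u k i else 0) is)
      = (\<Sum>k<r. tpow (u k) is)" for "is"
    using assms(2) by (intro sum.mono_neutral_cong_right) auto
  then show ?thesis using u T assms(3)
    by (intro cp_rank_weighted[where K = "{..<r'}" and a = "\<lambda>k. if k < r then 1 else 0"
          and u = "\<lambda>k i. if k < r then u k i else 0"]) auto
qed

text \<open>A linear relation among the rank-one terms, scaled by its largest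
  coefficient, removes one of them.\<close>

lemma cp_rank_caratheodory:
  assumes "cp_rank n m r T" "m > 0"
  shows "cp_rank n m (card (tindices n m)) T"
proof -
  define r0 where "r0 = (LEAST r. cp_rank n m r T)"
  have r0: "cp_rank n m r0 T" and least: "\<And>s. cp_rank n m s T \<Longrightarrow> r0 \<le> s"
    unfolding r0_def using assms(1) by (auto intro: LeastI Least_le)
  obtain u :: "nat \<Rightarrow> nat \<Rightarrow> real" where u: "\<forall>k<r0. \<forall>i<n. u k i \<ge> 0"
    and T: "\<And>is. is \<in> tindices n m \<Longrightarrow> T is = (\<Sum>k<r0. tpow (u k) is)"
    using r0 unfolding cp_rank_def by blast
  \<comment> \<open>With more terms than tensor entries, the rank-one terms are linearly dependent,
    and dropping one contradicts the minimality of \<open>r0\<close>.\<close>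
  have "r0 \<le> card (tindices n m)"
  proof (rule ccontr)
    assume "\<not> r0 \<le> card (tindices n m)"
    then have "card (tindices n m) < card {..<r0}" by simp
    from homogeneous_system_nontrivial_solution[OF finite_tindices _ this, of "\<lambda>k. tpow (u k)"]
    obtain l0 where l0: "\<exists>k<r0. l0 k \<noteq> 0"
      and l0_rel: "\<And>is. is \<in> tindices n m \<Longrightarrow> (\<Sum>k<r0. l0 k * tpow (u k) is) = 0"
      by auto
    \<comment> \<open>Flipping the sign of the relation if necessary provides a positive
      coefficient, so the maximal one can be divided by.\<close>
    obtain l where l: "\<exists>k<r0. l k > 0"
      and rel: "\<And>is. is \<in> tindices n m \<Longrightarrow> (\<Sum>k<r0. l k * tpow (u k) is) = 0"
    proof (cases "\<exists>k<r0. l0 k > 0")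
      case True
      then show thesis using that l0_rel by blast
    next
      case False
      show thesis
      proof (rule that[of "\<lambda>k. - l0 k"])
        show "\<exists>k<r0. - l0 k > 0" using False l0 by (metis linorder_neqE neg_0_less_iff_less)
      qed (use l0_rel in \<open>simp add: sum_negf\<close>)
    qed
    have "Max (l ` {..<r0}) \<in> l ` {..<r0}" using l by (intro Max_in) auto
    then obtain k0 where k0: "k0 < r0" "l k0 = Max (l ` {..<r0})" by auto
    have max: "l k \<le> l k0" if "k < r0" for k using that k0 by (simp add: Max_ge)
    have pos: "l k0 > 0" using l max by force
    \<comment> \<open>Subtracting the relation divided by \<open>l k0\<close> leaves weights
      \<open>1 - l k / l k0\<close>, nonnegative by maximality of \<open>l k0\<close> and zero at
      \<open>k0\<close>.\<close>
    have "cp_rank n m (r0 - 1) T"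
    proof (rule cp_rank_weighted[where K = "{..<r0} - {k0}" and u = u
          and a = "\<lambda>k. 1 - l k / l k0"])
      fix "is" assume "is": "is \<in> tindices n m"
      have "(\<Sum>k\<in>{..<r0} - {k0}. (1 - l k / l k0) * tpow (u k) is)
          = (\<Sum>k<r0. (1 - l k / l k0) * tpow (u k) is)"
        using k0 pos by (subst (2) sum.remove[of _ k0]) auto
      also have "\<dots> = (\<Sum>k<r0. tpow (u k) is) - (\<Sum>k<r0. l k * tpow (u k) is) / l k0"
        by (simp add: left_diff_distrib sum_subtractf sum_divide_distrib)
      finally show "T is = (\<Sum>k\<in>{..<r0} - {k0}. (1 - l k / l k0) * tpow (u k) is)"
        using T[OF "is"] rel[OF "is"] by simp
    qed (use max pos u k0 assms in auto)
    then show False using least[of "r0 - 1"] k0 by simp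
  qed
  then show ?thesis using cp_rank_mono[OF r0] assms(2) by simp
qed

section \<open>Closure under sums and Hadamard products\<close>

definition completely_positive :: "nat \<Rightarrow> nat \<Rightarrow> (nat list \<Rightarrow> real) \<Rightarrow> bool" where
  "completely_positive n m T \<longleftrightarrow> (\<exists>r. cp_rank n m r T)"

lemma completely_positive_sum:
  assumes "finite K" "m > 0"
    and "\<And>k. k \<in> K \<Longrightarrow> a k \<ge> 0"
    and "\<And>k i. k \<in> K \<Longrightarrow> i < n \<Longrightarrow> u k i \<ge> 0"
    and "\<And>is. is \<in> tindices n m \<Longrightarrow> T is = (\<Sum>k\<in>K. a k * tpow (u k) is)"
  shows "completely_positive n m T"
  unfolding completely_positive_def using cp_rank_weighted[OF assms(1) refl assms(2-)] by blast

lemma completely_positive_rank_one: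
  assumes "m > 0" "a \<ge> 0" "\<And>i. i < n \<Longrightarrow> u i \<ge> 0"
    and "\<And>is. is \<in> tindices n m \<Longrightarrow> T is = a * tpow u is"
  shows "completely_positive n m T"
  by (rule completely_positive_sum[where K = "{()}" and a = "\<lambda>_. a" and u = "\<lambda>_. u"])
     (use assms in auto)

lemma completely_positive_cong:
  assumes "completely_positive n m S" "\<And>is. is \<in> tindices n m \<Longrightarrow> T is = S is"
  shows "completely_positive n m T"
  using assms unfolding completely_positive_def cp_rank_def by simp

text \<open>Multiplying out the two sums gives Hadamard products of rank-one tensors, and these are
  rank-one tensors of entrywise products of vectors.\<close>

lemma completely_positive_mult:
  assumes "completely_positive n m S" "completely_positive n m T" "m > 0"
  shows "completely_positive n m (\<lambda>is. S is * T is)"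
proof -
  obtain r and u :: "nat \<Rightarrow> nat \<Rightarrow> real" where u: "\<forall>k<r. \<forall>i<n. u k i \<ge> 0"
    and S: "\<forall>is\<in>tindices n m. S is = (\<Sum>k<r. tpow (u k) is)"
    using assms(1) unfolding completely_positive_def cp_rank_def by blast
  obtain q and v :: "nat \<Rightarrow> nat \<Rightarrow> real" where v: "\<forall>k<q. \<forall>i<n. v k i \<ge> 0"
    and T: "\<forall>is\<in>tindices n m. T is = (\<Sum>k<q. tpow (v k) is)"
    using assms(2) unfolding completely_positive_def cp_rank_def by blast
  show ?thesis
    by (rule completely_positive_sum[where K = "{..<r} \<times> {..<q}" and a = "\<lambda>_. 1"
          and u = "\<lambda>(k, k') i. u k i * v k' i"])
       (use u v S T assms(3) in
        \<open>auto simp: tpow_mult sum_product sum.cartesian_product intro!: sum.cong\<close>)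
qed

lemma completely_positive_prod:
  assumes "finite K" "m > 0" "\<And>k. k \<in> K \<Longrightarrow> completely_positive n m (T k)"
  shows "completely_positive n m (\<lambda>is. \<Prod>k\<in>K. T k is)"
  using assms(1,3)
proof (induction K rule: finite_induct)
  case empty
  then show ?case using assms(2)
    by (intro completely_positive_rank_one[where a = 1 and u = "\<lambda>_. 1"]) (auto simp: tpow_const)
next
  case (insert k K)
  then have "completely_positive n m (\<lambda>is. T k is * (\<Prod>k\<in>K. T k is))"
    by (intro completely_positive_mult) (auto simp: assms(2))
  then show ?case using insert by simp
qed

section \<open>Closure under limits\<close>

text \<open>Bolzano-Weierstrass, refining the subsequence once per coordinate.\<close>

lemma common_convergent_subsequence:
  fixes x :: "nat \<Rightarrow> 'i \<Rightarrow> real"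
  assumes "finite I" "\<And>i. i \<in> I \<Longrightarrow> Bseq (\<lambda>N. x N i)"
  shows "\<exists>\<phi>. strict_mono (\<phi> :: nat \<Rightarrow> nat) \<and> (\<forall>i\<in>I. convergent (\<lambda>N. x (\<phi> N) i))"
  using assms
proof (induction I rule: finite_induct)
  case empty
  then show ?case by (intro exI[of _ id]) (auto simp: strict_mono_def)
next
  case (insert i I)
  then obtain \<phi> :: "nat \<Rightarrow> nat"
    where \<phi>: "strict_mono \<phi>" "\<And>j. j \<in> I \<Longrightarrow> convergent (\<lambda>N. x (\<phi> N) j)"
    by auto
  have "bounded (range (\<lambda>N. x (\<phi> N) i))"
    using insert.prems[of i] by (auto simp: Bseq_eq_bounded intro: bounded_subset)
  then obtain l \<psi> where \<psi>: "strict_mono (\<psi> :: nat \<Rightarrow> nat)" "((\<lambda>N. x (\<phi> N) i) \<circ> \<psi>) \<longlonglongrightarrow> l"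
    using bounded_imp_convergent_subsequence by blast
  have "convergent (\<lambda>N. x ((\<phi> \<circ> \<psi>) N) j)" if "j \<in> insert i I" for j
    using that \<phi>(2)[of j] \<psi> convergent_subseq_convergent[of "\<lambda>N. x (\<phi> N) j" \<psi>]
    by (auto simp: convergent_def o_def)
  then show ?case using strict_mono_o[OF \<phi>(1) \<psi>(1)] by blast
qed

text \<open>By Caratheodory all \<open>T N\<close> have decompositions with the same number
  \<open>D\<close> of terms. The vectors stay bounded, so along a subsequence they converge to
  vectors that decompose \<open>S\<close>.\<close>

lemma completely_positive_limit:
  assumes cp: "\<And>N. completely_positive n m (T N)" and m: "m > 0"
    and lim: "\<And>is. is \<in> tindices n m \<Longrightarrow> (\<lambda>N. T N is) \<longlonglongrightarrow> S is"
  shows "completely_positive n m S"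
proof -
  define D where "D = card (tindices n m)"
  have "\<forall>N. cp_rank n m D (T N)"
    using cp m by (auto simp: completely_positive_def D_def intro: cp_rank_caratheodory)
  then obtain u where u: "\<And>N k i. k < D \<Longrightarrow> i < n \<Longrightarrow> u N k i \<ge> 0"
    and T: "\<And>N is. is \<in> tindices n m \<Longrightarrow> T N is = (\<Sum>k<D. tpow (u N k) is)"
    unfolding cp_rank_def by metis
  \<comment> \<open>The diagonal entry at \<open>replicate m i\<close> is the sum of the nonnegative
    numbers \<open>u N k i ^ m\<close> and converges in \<open>N\<close>, so it bounds each of them
    uniformly.\<close>
  have bdd: "Bseq (\<lambda>N. u N k i)" if ki: "k < D" "i < n" for k i
  proof -
    have "Bseq (\<lambda>N. T N (replicate m i))"
      using lim[OF replicate_in_tindices[OF ki(2)]] by (auto intro: convergent_imp_Bseq convergentI)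
    then obtain B where B: "\<And>N. \<bar>T N (replicate m i)\<bar> \<le> B" by (auto simp: Bseq_def)
    have "u N k i \<le> root m B" for N
    proof -
      have "u N k i ^ m = tpow (u N k) (replicate m i)" by (simp add: tpow_def)
      also have "\<dots> \<le> (\<Sum>k<D. tpow (u N k) (replicate m i))"
        using ki u by (intro member_le_sum) (auto simp: tpow_def)
      also have "\<dots> \<le> B" using T[OF replicate_in_tindices[OF ki(2)]] B[of N] by simp
      finally show ?thesis using real_root_le_mono[OF m] u[OF ki] m
        by (metis real_root_power_cancel)
    qed
    then show ?thesis using u[OF ki] by (intro BseqI'[where K = "root m B"]) auto
  qed
  have "\<exists>\<phi>. strict_mono (\<phi> :: nat \<Rightarrow> nat) \<and>
      (\<forall>p\<in>{..<D} \<times> {..<n}. convergent (\<lambda>N. u (\<phi> N) (fst p) (snd p)))"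
    by (rule common_convergent_subsequence[where x = "\<lambda>N p. u N (fst p) (snd p)"])
       (auto intro: bdd)
  then obtain \<phi> where \<phi>: "strict_mono (\<phi> :: nat \<Rightarrow> nat)"
    and "\<And>k i. k < D \<Longrightarrow> i < n \<Longrightarrow> convergent (\<lambda>N. u (\<phi> N) k i)" by auto
  then obtain v where v: "\<And>k i. k < D \<Longrightarrow> i < n \<Longrightarrow> (\<lambda>N. u (\<phi> N) k i) \<longlonglongrightarrow> v k i"
    unfolding convergent_def by metis
  have tp: "(\<lambda>N. tpow (u (\<phi> N) k) is) \<longlonglongrightarrow> tpow (v k) is"
    if "k < D" "set is \<subseteq> {..<n}" for k "is"
    using that(2) by (induction "is") (auto simp: tpow_def intro!: tendsto_intros v that(1))
  have "S is = (\<Sum>k<D. tpow (v k) is)" if "is": "is \<in> tindices n m" for "is"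
  proof (rule LIMSEQ_unique)
    show "(\<lambda>N. T (\<phi> N) is) \<longlonglongrightarrow> S is"
      using LIMSEQ_subseq_LIMSEQ[OF lim[OF "is"] \<phi>] by (simp add: o_def)
    show "(\<lambda>N. T (\<phi> N) is) \<longlonglongrightarrow> (\<Sum>k<D. tpow (v k) is)"
      unfolding T[OF "is"] using "is" by (intro tendsto_sum tp) (auto simp: tindices_def)
  qed
  moreover have "v k i \<ge> 0" if "k < D" "i < n" for k i
    using v[OF that] u[OF that] by (intro LIMSEQ_le_const) auto
  ultimately show ?thesis unfolding completely_positive_def cp_rank_def by blast
qed

section \<open>Powers of the Gamma function\<close>

text \<open>The signs cancel, so for \<alpha> > 0 the binomial series of
  \<open>(1 - t) powr - \<alpha>\<close> has nonnegative coefficients.\<close>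

lemma gbinomial_minus_alternating:
  fixes \<alpha> :: real
  shows "(- \<alpha> gchoose j) * (- 1) ^ j = pochhammer \<alpha> j / fact j"
  by (simp add: gbinomial_pochhammer flip: power_mult_distrib)

lemma completely_positive_inverse_powr:
  assumes c: "\<And>i. i < n \<Longrightarrow> c i \<ge> 0" and "\<alpha> > 0" "m > 0" "d > 0"
  shows "completely_positive n m (\<lambda>is. (sum_list (map c is) + d) powr - \<alpha>)"
proof -
  define s where "s = (\<lambda>is. sum_list (map c is) + d)"
  have s: "s is > 0" if "is \<in> tindices n m" for "is"
    using that c \<open>d > 0\<close> unfolding s_def tindices_def
    by (intro add_nonneg_pos sum_list_nonneg) auto
  \<comment> \<open>Put \<open>t = exp (- h * s is)\<close>, which lies strictly between 0 and 1.
    Each \<open>t ^ j\<close> is a constant times a rank-one tensor because \<open>s\<close> is a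
    constant plus a sum over the indices.\<close>
  have 1: "completely_positive n m (\<lambda>is. (1 - exp (- h * s is)) powr - \<alpha>)" if "h > 0" for h
  proof (rule completely_positive_limit[OF _ \<open>m > 0\<close>])
    fix J :: nat
    show "completely_positive n m
       (\<lambda>is. \<Sum>j<J. (- \<alpha> gchoose j) * (- exp (- h * s is)) ^ j)"
    proof (rule completely_positive_sum[OF finite_lessThan \<open>m > 0\<close>,
          where a = "\<lambda>j. pochhammer \<alpha> j / fact j * exp (- h * j * d)"
            and u = "\<lambda>j i. exp (- h * j * c i)"])
      fix "is"
      have "(- exp (- h * s is)) ^ j
          = (- 1) ^ j * (exp (- h * j * d) * exp (- h * j * sum_list (map c is)))" for j
      proof -
        have "exp (- h * s is) ^ j = exp (- h * j * d) * exp (- h * j * sum_list (map c is))"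
          unfolding exp_of_nat_mult[symmetric] exp_add[symmetric] by (simp add: s_def algebra_simps)
        then show ?thesis by (metis power_minus)
      qed
      moreover have "tpow (\<lambda>i. exp (- h * j * c i)) is = exp (- h * j * sum_list (map c is))"
        for j :: nat by (rule tpow_exp)
      ultimately show "(\<Sum>j<J. (- \<alpha> gchoose j) * (- exp (- h * s is)) ^ j)
        = (\<Sum>j<J. pochhammer \<alpha> j / fact j * exp (- h * j * d) * tpow (\<lambda>i. exp (- h * j * c i)) is)"
        by (simp only: gbinomial_minus_alternating[symmetric] mult_ac)
    qed (use \<open>\<alpha> > 0\<close> in \<open>auto simp: pochhammer_nonneg\<close>)
  next
    fix "is" assume "is \<in> tindices n m"
    then have "h * s is > 0" using s \<open>h > 0\<close> by simp
    then show "(\<lambda>J. \<Sum>j<J. (- \<alpha> gchoose j) * (- exp (- h * s is)) ^ j)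
        \<longlonglongrightarrow> (1 - exp (- h * s is)) powr - \<alpha>"
      using gen_binomial_real[of "- exp (- h * s is)" "- \<alpha>"] by (simp add: sums_def)
  qed
  \<comment> \<open>Take \<open>h = 1 / Suc N\<close>. The factor \<open>h powr \<alpha>\<close>
    replaces \<open>1 - exp (- h * s is)\<close> by its difference quotient at 0, which tends to the
    derivative \<open>s is\<close>.\<close>
  show ?thesis
  proof (rule completely_positive_limit[OF _ \<open>m > 0\<close>])
    fix N :: nat
    define h where "h = 1 / real (Suc N)"
    have "h > 0" by (simp add: h_def)
    show "completely_positive n m
       (\<lambda>is. (1 / real (Suc N)) powr \<alpha> * (1 - exp (- (1 / real (Suc N)) * s is)) powr - \<alpha>)"
      unfolding h_def[symmetric] using \<open>m > 0\<close>
      by (intro completely_positive_mult 1[OF \<open>h > 0\<close>]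
          completely_positive_rank_one[where a = "h powr \<alpha>" and u = "\<lambda>_. 1"]) (auto simp: tpow_const)
  next
    fix "is" assume "is \<in> tindices n m"
    note s = s[OF this]
    have "((\<lambda>h. (1 - exp (- h * s is)) / h) \<longlongrightarrow> s is) (at_right 0)"
    proof -
      have "((\<lambda>h. 1 - exp (- h * s is)) has_real_derivative s is) (at 0)"
        by (auto intro!: derivative_eq_intros)
      then have "((\<lambda>h. (1 - exp (- h * s is)) / h) \<longlongrightarrow> s is) (at 0)"
        by (simp add: has_field_derivative_iff)
      then show ?thesis by (rule filterlim_mono) (auto simp: at_le)
    qed
    moreover have "filterlim (\<lambda>N. 1 / real (Suc N)) (at_right 0) sequentially"
      unfolding filterlim_at using LIMSEQ_inverse_real_of_nat
      by (auto simp: inverse_eq_divide)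
    ultimately have "(\<lambda>N. (1 - exp (- (1 / real (Suc N)) * s is)) / (1 / real (Suc N))) \<longlonglongrightarrow> s is"
      by (rule filterlim_compose)
    then have "(\<lambda>N. ((1 - exp (- (1 / real (Suc N)) * s is)) / (1 / real (Suc N))) powr - \<alpha>)
        \<longlonglongrightarrow> s is powr - \<alpha>"
      using s by (intro tendsto_powr) auto
    moreover have "((1 - exp (- h * s is)) / h) powr - \<alpha>
        = h powr \<alpha> * (1 - exp (- h * s is)) powr - \<alpha>" if "h > 0" for h
      using that s by (simp add: powr_divide powr_minus field_simps)
    then have "((1 - exp (- (1 / real (Suc N)) * s is)) / (1 / real (Suc N))) powr - \<alpha>
        = (1 / real (Suc N)) powr \<alpha> * (1 - exp (- (1 / real (Suc N)) * s is)) powr - \<alpha>" for N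
      by (metis of_nat_0_less_iff zero_less_Suc zero_less_divide_1_iff)
    ultimately show "(\<lambda>N. (1 / real (Suc N)) powr \<alpha> * (1 - exp (- (1 / real (Suc N)) * s is)) powr - \<alpha>)
        \<longlonglongrightarrow> (sum_list (map c is) + d) powr - \<alpha>"
      by (simp only: s_def)
  qed
qed

lemma prod_powr_distrib:
  fixes x :: "'a \<Rightarrow> real"
  assumes "\<And>k. k \<in> K \<Longrightarrow> x k \<ge> 0"
  shows "(\<Prod>k\<in>K. x k) powr a = (\<Prod>k\<in>K. x k powr a)"
  using assms by (induction K rule: infinite_finite_induct) (auto simp: powr_mult prod_nonneg)

lemma completely_positive_Gamma_powr:
  assumes c: "\<And>i. i < n \<Longrightarrow> c i \<ge> 0" and "\<alpha> > 0" "m > 0"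
  shows "completely_positive n m (\<lambda>is. Gamma (sum_list (map c is) + 1) powr \<alpha>)"
proof (rule completely_positive_limit[OF _ \<open>m > 0\<close>])
  define s where "s = (\<lambda>is. sum_list (map c is))"
  have s: "s is \<ge> 0" if "is \<in> tindices n m" for "is"
    using that c unfolding s_def tindices_def by (intro sum_list_nonneg) auto
  fix N :: nat
  \<comment> \<open>\<open>exp (b * s is)\<close> is the factor of the numerator of Euler's product
    that depends on the indices, raised to the power \<alpha>. The same \<open>ln (real N)\<close>
    occurs on both sides of the identity below, so \<open>N = 0\<close> needs no separate
    case.\<close>
  define b where "b = \<alpha> * ln (real N)"
  have cp: "completely_positive n m (\<lambda>is. (fact N powr \<alpha> * exp b * tpow (\<lambda>i. exp (b * c i)) is)
      * (\<Prod>k\<in>{0..N}. (sum_list (map c is) + (1 + real k)) powr - \<alpha>))"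
    using assms
    by (intro completely_positive_mult completely_positive_prod completely_positive_inverse_powr
        completely_positive_rank_one[OF _ _ _ refl]) auto
  show "completely_positive n m (\<lambda>is. Gamma_series (sum_list (map c is) + 1) N powr \<alpha>)"
  proof (rule completely_positive_cong[OF cp])
    fix "is" assume "is": "is \<in> tindices n m"
    have "pochhammer (s is + 1) (Suc N) = (\<Prod>k\<in>{0..N}. s is + (1 + real k))"
      by (simp add: pochhammer_prod add_ac atLeastLessThanSuc_atLeastAtMost)
    moreover have "exp ((s is + 1) * ln (real N)) powr \<alpha> = exp b * exp (b * s is)"
      by (simp add: powr_def b_def exp_add[symmetric] algebra_simps)
    ultimately have "Gamma_series (s is + 1) N powr \<alpha>
      = (fact N powr \<alpha> * exp b * exp (b * s is)) * (\<Prod>k\<in>{0..N}. s is + (1 + real k)) powr - \<alpha>"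
      using s[OF "is"] unfolding Gamma_series_def
      by (simp add: powr_divide powr_mult powr_minus prod_nonneg field_simps)
    also have "(\<Prod>k\<in>{0..N}. s is + (1 + real k)) powr - \<alpha>
        = (\<Prod>k\<in>{0..N}. (s is + (1 + real k)) powr - \<alpha>)"
      using s[OF "is"] by (intro prod_powr_distrib) auto
    finally show "Gamma_series (sum_list (map c is) + 1) N powr \<alpha> =
      (fact N powr \<alpha> * exp b * tpow (\<lambda>i. exp (b * c i)) is)
      * (\<Prod>k\<in>{0..N}. (sum_list (map c is) + (1 + real k)) powr - \<alpha>)"
      by (simp add: tpow_exp s_def)
  qed
next
  fix "is" assume "is \<in> tindices n m"
  then have "sum_list (map c is) \<ge> 0"
    using c by (intro sum_list_nonneg) (auto simp: tindices_def)
  then have "Gamma (sum_list (map c is) + 1) \<noteq> 0"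
    using Gamma_real_pos[of "sum_list (map c is) + 1"] by linarith
  then show "(\<lambda>N. Gamma_series (sum_list (map c is) + 1) N powr \<alpha>)
      \<longlonglongrightarrow> Gamma (sum_list (map c is) + 1) powr \<alpha>"
    by (intro tendsto_powr Gamma_series_LIMSEQ tendsto_const)
qed

text \<open>The denominators form a positive rank-one tensor, so their power is a rank-one Hadamard
  factor of the power of the Gamma tensor.\<close>

lemma completely_positive_hadamard_powr_pascal:
  assumes c: "\<forall>i<n. c i \<ge> 0" and "\<alpha> > 0" "m > 0"
  shows "completely_positive n m (hadamard_powr_tensor (pascal_tensor c) \<alpha>)"
proof -
  have G: "Gamma (c i + 1) > 0" if "i < n" for i
    using c that by (intro Gamma_real_pos) (simp add: add_nonneg_pos)
  have "completely_positive n m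
     (\<lambda>is. 1 * tpow (\<lambda>i. Gamma (c i + 1) powr - \<alpha>) is * Gamma (sum_list (map c is) + 1) powr \<alpha>)"
    using assms by (intro completely_positive_mult completely_positive_Gamma_powr
        completely_positive_rank_one[OF _ _ _ refl]) auto
  then show ?thesis
  proof (rule completely_positive_cong)
    fix "is" assume "is": "is \<in> tindices n m"
    have pr: "prod_list (map (\<lambda>i. Gamma (c i + 1)) is) > 0 \<and>
       prod_list (map (\<lambda>i. Gamma (c i + 1)) is) powr - \<alpha>
         = tpow (\<lambda>i. Gamma (c i + 1) powr - \<alpha>) is" if "set is \<subseteq> {..<n}" for "is"
      using that by (induction "is") (auto simp: tpow_def G powr_mult less_imp_le)
    have "sum_list (map c is) \<ge> 0"
      using c "is" by (intro sum_list_nonneg) (auto simp: tindices_def)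
    then have "Gamma (sum_list (map c is) + 1) > 0"
      by (intro Gamma_real_pos) simp
    then show "hadamard_powr_tensor (pascal_tensor c) \<alpha> is = 1 * tpow (\<lambda>i. Gamma (c i + 1) powr - \<alpha>) is
        * Gamma (sum_list (map c is) + 1) powr \<alpha>"
      using pr[of "is"] "is" unfolding tindices_def hadamard_powr_tensor_def pascal_tensor_def
      by (auto simp: powr_divide powr_minus field_simps)
  qed
qed

section \<open>Contraction to the Pascal matrix\<close>

text \<open>Each further index 0 adds \<open>c 0 = 0\<close> to the sum and the factor
  \<open>Gamma 1 = 1\<close> to the denominator.\<close>

lemma pascal_tensor_contract:
  assumes "c 0 = 0"
  shows "pascal_tensor c (i # j # replicate k 0) = pascal_matrix c i j"
  using assms by (simp add: pascal_tensor_def pascal_matrix_def sum_list_replicate add_ac)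

theorem theorem4p3:
  fixes n m :: nat and \<alpha> :: real and c :: "nat \<Rightarrow> real"
  assumes "n \<ge> 2" and "\<alpha> > 0"
    and "\<forall>i<n. c i \<ge> 0" and "c 0 = 0"
    and "matrix_pos_def n (hadamard_powr_matrix (pascal_matrix c) \<alpha>)"
    and "m \<ge> 2"
  shows "strongly_completely_positive n m (hadamard_powr_tensor (pascal_tensor c) \<alpha>)
    \<and> (even m \<longrightarrow> tensor_pos_def n m (hadamard_powr_tensor (pascal_tensor c) \<alpha>))"
proof -
  define A where "A = hadamard_powr_tensor (pascal_tensor c) \<alpha>"
  define Q where "Q = hadamard_powr_matrix (pascal_matrix c) \<alpha>"
  have Q: "matrix_pos_def n Q" using assms by (simp add: Q_def)
  have "completely_positive n m A"
    unfolding A_def using assms by (intro completely_positive_hadamard_powr_pascal) auto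
  then obtain r and u :: "nat \<Rightarrow> nat \<Rightarrow> real" where u: "\<forall>k<r. \<forall>i<n. u k i \<ge> 0"
    and A: "\<forall>is\<in>tindices n m. A is = (\<Sum>k<r. tpow (u k) is)"
    unfolding completely_positive_def cp_rank_def by blast
  \<comment> \<open>Fixing the last \<open>m - 2\<close> indices to be 0 turns the rank-one tensor
    of \<open>u k\<close> into the rank-one matrix of \<open>u k\<close> with weight
    \<open>u k 0 ^ (m - 2)\<close>.\<close>
  have Q_eq: "Q i j = (\<Sum>k<r. u k i * u k j * u k 0 ^ (m - 2))" if "i < n" "j < n" for i j
  proof -
    have "i # j # replicate (m - 2) 0 \<in> tindices n m"
      using that assms by (auto simp: tindices_def)
    then have "A (i # j # replicate (m - 2) 0) = (\<Sum>k<r. tpow (u k) (i # j # replicate (m - 2) 0))"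
      using A by blast
    then show ?thesis
      by (simp add: A_def Q_def hadamard_powr_tensor_def hadamard_powr_matrix_def
          pascal_tensor_contract[of c, OF \<open>c 0 = 0\<close>] tpow_def mult.assoc)
  qed
  have Q_mult: "(\<Sum>j<n. Q i j * y j) = (\<Sum>k<r. (u k 0 ^ (m - 2) * (\<Sum>j<n. u k j * y j)) * u k i)"
    if "i < n" for i y
  proof -
    have "(\<Sum>j<n. Q i j * y j) = (\<Sum>j<n. \<Sum>k<r. u k i * u k j * u k 0 ^ (m - 2) * y j)"
      using that by (simp add: Q_eq sum_distrib_right)
    also have "\<dots> = (\<Sum>k<r. \<Sum>j<n. u k i * u k j * u k 0 ^ (m - 2) * y j)"
      by (rule sum.swap)
    finally show ?thesis by (simp add: sum_distrib_left sum_distrib_right mult_ac)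
  qed
  \<comment> \<open>The range of \<open>Q\<close> lies in the span of the vectors
    \<open>u k\<close>, and definiteness makes it the whole space.\<close>
  have span: "\<exists>a. \<forall>i<n. x i = (\<Sum>k<r. a k * u k i)" for x
  proof -
    obtain y where "\<forall>i<n. x i = (\<Sum>j<n. Q i j * y j)"
      using matrix_pos_def_solvable[OF Q] by blast
    then show ?thesis
      by (intro exI[of _ "\<lambda>k. u k 0 ^ (m - 2) * (\<Sum>j<n. u k j * y j)"]) (simp add: Q_mult)
  qed
  have "strongly_completely_positive n m A"
    unfolding strongly_completely_positive_def using u span A by blast
  moreover have "tensor_pos_def n m A" if "even m"
    unfolding tensor_pos_def_def
  proof (intro allI impI)
    fix x :: "nat \<Rightarrow> real" assume x: "\<exists>i<n. x i \<noteq> 0"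
    have "(\<Sum>is\<in>tindices n m. A is * prod_list (map x is))
        = (\<Sum>is\<in>tindices n m. \<Sum>k<r. tpow (u k) is * prod_list (map x is))"
      using A by (simp add: sum_distrib_right)
    also have "\<dots> = (\<Sum>k<r. \<Sum>is\<in>tindices n m. tpow (u k) is * prod_list (map x is))"
      by (rule sum.swap)
    also have "\<dots> = (\<Sum>k<r. (\<Sum>i<n. u k i * x i) ^ m)" by (simp add: sum_tpow_mult)
    finally have eq: "(\<Sum>is\<in>tindices n m. A is * prod_list (map x is))
        = (\<Sum>k<r. (\<Sum>i<n. u k i * x i) ^ m)" .
    \<comment> \<open>If \<open>x\<close> were orthogonal to all \<open>u k\<close>, then
      \<open>Q\<close> would annihilate \<open>x\<close>, contradicting its definiteness.\<close>
    have "\<exists>k<r. (\<Sum>i<n. u k i * x i) \<noteq> 0"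
    proof (rule ccontr)
      assume "\<not> ?thesis"
      then have "(\<Sum>j<n. Q i j * x j) = 0" if "i < n" for i using that by (simp add: Q_mult)
      moreover have "(\<Sum>i<n. \<Sum>j<n. Q i j * x i * x j) = (\<Sum>i<n. x i * (\<Sum>j<n. Q i j * x j))"
        by (simp add: sum_distrib_left mult_ac)
      ultimately have "(\<Sum>i<n. \<Sum>j<n. Q i j * x i * x j) = 0" by simp
      then show False using Q x by (auto simp: matrix_pos_def_def)
    qed
    then obtain k where k: "k < r" "(\<Sum>i<n. u k i * x i) \<noteq> 0" by blast
    have "(\<Sum>k<r. (\<Sum>i<n. u k i * x i) ^ m) > 0"
      using k \<open>even m\<close> by (intro sum_pos2[where i = k]) (auto simp: zero_less_power_eq zero_le_even_power)
    then show "(\<Sum>is\<in>tindices n m. A is * prod_list (map x is)) > 0" using eq by simp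
  qed
  ultimately show ?thesis by (simp add: A_def)
qed

end
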